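(* Let $\mathcal{A}'$ be a generic arrangement of $d'\ge 3$ lines in the complex projective plane $\mathbb{P}^2$, let $p\in\mathbb{P}^2$ be an arbitrary point not lying on any line of $\mathcal{A}'$, let $e\ge 0$ be an integer, and let $\mathcal{A}=C(\mathcal{A}')_e$ be a cone over $\mathcal{A}'$ with vertex $p$. Then the supersolvable line arrangement $\mathcal{A}$ satisfies $n_2\ge \frac{d}{2}$, where $d=|\mathcal{A}|$ and $n_2$ is the number of double points of $\mathcal{A}$.
   Context: A line arrangement in $\mathbb{P}^2$ is a finite set of distinct lines. An intersection point is a point lying on at least two lines of the arrangement; its multiplicity is the number of lines through it, and a double point is an intersection point of multiplicity exactly $2$. An arrangement is generic if all its intersection points are double points. An arrangement is supersolvable if it has a modular point, that is, an intersection point $p$ such that for every other intersection point $q$ the line $\overline{pq}$ belongs to the arrangement. Cones: let $\mathcal{A}'$ be a line arrangement and $p\in\mathbb{P}^2$ a point not situated on any line of $\mathcal{A}'$ (the vertex). The arrangement $C(\mathcal{A}')_0=C(\mathcal{A}',p)_0$ is obtained by adding to the lines of $\mathcal{A}'$ all the lines joining $p$ to the intersection points of $\mathcal{A}'$. For $e\ge 0$, a cone $C(\mathcal{A}')_e=C(\mathcal{A}',p)_e$ is obtained from $C(\mathcal{A}')_0$ by adding $e$ new distinct lines through $p$ which meet $\mathcal{A}'$ only at simple points (i.e. contain no intersection point of $\mathcal{A}'$). *)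

theory Defs
  imports "HOL-Analysis.Analysis"
begin

text \<open>Points and lines of the complex projective plane are the complex subspaces of
  \<open>complex ^ 3\<close> of dimension 1 and 2 respectively. The constants \<open>vec.subspace\<close>, \<open>vec.dim\<close> and
  \<open>vec.span\<close> refer to scalar multiplication by complex numbers, as opposed to
  \<open>subspace\<close>, \<open>dim\<close> and \<open>span\<close>, which are over the reals. Incidence is inclusion.\<close>

definition proj_point :: "(complex ^ 3) set \<Rightarrow> bool" where
  "proj_point P \<longleftrightarrow> vec.subspace P \<and> vec.dim P = 1"

definition proj_line :: "(complex ^ 3) set \<Rightarrow> bool" where
  "proj_line L \<longleftrightarrow> vec.subspace L \<and> vec.dim L = 2"

definition lies_on :: "(complex ^ 3) set \<Rightarrow> (complex ^ 3) set \<Rightarrow> bool" (infix "lies'_on" 50) where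
  "P lies_on L \<longleftrightarrow> P \<subseteq> L"

text \<open>This is the line through two points only when these are distinct.\<close>

definition join :: "(complex ^ 3) set \<Rightarrow> (complex ^ 3) set \<Rightarrow> (complex ^ 3) set" where
  "join P Q = vec.span (P \<union> Q)"

definition line_arrangement :: "(complex ^ 3) set set \<Rightarrow> bool" where
  "line_arrangement A \<longleftrightarrow> finite A \<and> (\<forall>L\<in>A. proj_line L)"

definition intersection_points :: "(complex ^ 3) set set \<Rightarrow> (complex ^ 3) set set" where
  "intersection_points A =
     {P. proj_point P \<and> (\<exists>L\<in>A. \<exists>M\<in>A. L \<noteq> M \<and> P lies_on L \<and> P lies_on M)}"

definition point_mult :: "(complex ^ 3) set set \<Rightarrow> (complex ^ 3) set \<Rightarrow> nat" where
  "point_mult A P = card {L \<in> A. P lies_on L}"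

definition double_points :: "(complex ^ 3) set set \<Rightarrow> (complex ^ 3) set set" where
  "double_points A = {P \<in> intersection_points A. point_mult A P = 2}"

definition generic_arrangement :: "(complex ^ 3) set set \<Rightarrow> bool" where
  "generic_arrangement A \<longleftrightarrow>
     line_arrangement A \<and> (\<forall>P\<in>intersection_points A. P \<in> double_points A)"

definition modular_point :: "(complex ^ 3) set set \<Rightarrow> (complex ^ 3) set \<Rightarrow> bool" where
  "modular_point A P \<longleftrightarrow>
     P \<in> intersection_points A \<and>
     (\<forall>Q\<in>intersection_points A. Q \<noteq> P \<longrightarrow> join P Q \<in> A)"

definition supersolvable :: "(complex ^ 3) set set \<Rightarrow> bool" where
  "supersolvable A \<longleftrightarrow> line_arrangement A \<and> (\<exists>P. modular_point A P)"

definition cone0 :: "(complex ^ 3) set set \<Rightarrow> (complex ^ 3) set \<Rightarrow> (complex ^ 3) set set" where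
  "cone0 A P = A \<union> join P ` intersection_points A"

text \<open>A cone is not determined by \<open>A\<close>, \<open>P\<close> and \<open>e\<close>, as the \<open>e\<close> additional lines can be chosen;
  hence the relation \<open>is_cone A P e B\<close>, saying that \<open>B\<close> is one of the cones. It is meant for
  vertices \<open>P\<close> on no line of \<open>A\<close>.\<close>

definition is_cone ::
  "(complex ^ 3) set set \<Rightarrow> (complex ^ 3) set \<Rightarrow> nat \<Rightarrow> (complex ^ 3) set set \<Rightarrow> bool" where
  "is_cone A P e B \<longleftrightarrow>
     (\<exists>E. finite E \<and> card E = e \<and> E \<inter> cone0 A P = {} \<and>
          (\<forall>L\<in>E. proj_line L \<and> P lies_on L \<and> (\<forall>Q\<in>intersection_points A. \<not> Q lies_on L)) \<and>
          B = cone0 A P \<union> E)"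

end

theory Submission
  imports Defs "HOL-Computational_Algebra.Polynomial"
begin

text \<open>Let \<open>n\<close> be the number of lines of the generic arrangement and \<open>r\<close> the number of lines of the cone
  through its vertex \<open>p\<close>. Each of the \<open>n\<close> lines meets exactly \<open>n - 1\<close> lines through \<open>p\<close> in an
  intersection point of the generic arrangement; its meeting points with the other \<open>r - n + 1\<close>
  are double points of the cone. Hence there are at least \<open>n (r - n + 1)\<close> double points, which is
  at least \<open>(n + r) / 2\<close> as soon as \<open>r \<ge> n\<close>.

  It remains to exclude \<open>r = n - 1\<close>. In that case the \<open>n\<close> lines meet each line \<open>X\<close> through \<open>p\<close> in
  \<open>m = n / 2\<close> points, two at a time, so the product \<open>F\<close> of their equations is a square on \<open>X\<close>.
  Normalise \<open>F\<close> to be monic in a variable \<open>T\<close> running along the lines through \<open>p\<close>, and let \<open>G\<close> be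
  its truncated square root, a polynomial of total degree \<open>m\<close>, monic in \<open>T\<close>, such that \<open>F - G\<^sup>2\<close> has
  degree less than \<open>m\<close> in \<open>T\<close>. On each \<open>X\<close> the square root of \<open>F\<close> must be \<open>G\<close>. So \<open>G\<close> vanishes at
  \<open>n - 1 > m\<close> points of each of the \<open>n\<close> lines, hence on all of these lines, although its degree is
  \<open>m < n\<close>.\<close>

section \<open>Total degree in two variables and the truncated square root\<close>

text \<open>The outer index \<open>i\<close> is the exponent of \<open>T\<close>, the inner index
  \<open>k\<close> that of \<open>s\<close>. The zero polynomial satisfies every bound.\<close>

definition total_degree_le :: "nat \<Rightarrow> 'a::zero poly poly \<Rightarrow> bool" where
  "total_degree_le n F \<longleftrightarrow> (\<forall>i k. n < i + k \<longrightarrow> coeff (coeff F i) k = 0)"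

lemma total_degree_le_mult:
  assumes "total_degree_le a F" "total_degree_le b G"
  shows "total_degree_le (a + b) (F * G)"
  unfolding total_degree_le_def
proof (intro allI impI)
  fix i k assume ik: "a + b < i + k"
  have "coeff (coeff F j) l * coeff (coeff G (i - j)) (k - l) = 0" if "j \<le> i" "l \<le> k" for j l
  proof -
    have "a < j + l \<or> b < (i - j) + (k - l)" using ik that by linarith
    thus ?thesis using assms unfolding total_degree_le_def by auto
  qed
  hence "(\<Sum>j\<le>i. \<Sum>l\<le>k. coeff (coeff F j) l * coeff (coeff G (i - j)) (k - l)) = 0"
    by (intro sum.neutral ballI) (simp only: atMost_iff)
  thus "coeff (coeff (F * G) i) k = 0"
    by (simp add: coeff_mult coeff_sum)
qed

lemma total_degree_le_prod:
  assumes "finite I" "\<And>i. i \<in> I \<Longrightarrow> total_degree_le 1 (f i)"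
  shows "total_degree_le (card I) (prod f I)"
  using assms
proof (induction I rule: finite_induct)
  case empty
  show ?case by (auto simp: total_degree_le_def coeff_1 split: if_splits)
next
  case (insert x I)
  then have "total_degree_le (1 + card I) (f x * prod f I)"
    by (intro total_degree_le_mult) auto
  with insert show ?case by simp
qed

lemma total_degree_le_linear_factor:
  assumes "degree r \<le> 1"
  shows "total_degree_le 1 [:-r, 1:]"
proof -
  have "coeff r k = 0" if "1 < k" for k
    using assms that by (intro coeff_eq_0) linarith
  thus ?thesis
    by (auto simp: total_degree_le_def coeff_pCons coeff_1 split: nat.splits if_splits)
qed

text \<open>Replacing \<open>T\<close> by an expression of degree at most 1 in \<open>s\<close>
  cannot raise the degree of any monomial. This bounds the number of zeros of a plane curve on a
  line.\<close>

lemma degree_poly_le_total_degree: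
  fixes r :: "'a::comm_semiring_1 poly"
  assumes "total_degree_le n F" "degree r \<le> 1"
  shows "degree (poly F r) \<le> n"
  unfolding poly_altdef
proof (rule degree_sum_le)
  fix i assume "i \<in> {..degree F}"
  show "degree (coeff F i * r ^ i) \<le> n"
  proof (cases "coeff F i = 0")
    case False
    have "coeff (coeff F i) (degree (coeff F i)) \<noteq> 0" using False by simp
    hence "i + degree (coeff F i) \<le> n"
      using assms(1) unfolding total_degree_le_def by (meson not_le)
    moreover have "degree (r ^ i) \<le> i"
      using degree_power_le[of r i] mult_le_mono1[OF assms(2), of i] by linarith
    ultimately show ?thesis
      using degree_mult_le[of "coeff F i" "r ^ i"] by linarith
  qed simp
qed simp

text \<open>Start with \<open>T^m\<close> and correct one coefficient per step: as \<open>G\<close>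
  is monic in \<open>T\<close>, adding \<open>(c/2) T^j\<close> changes the coefficient of
  \<open>T^(m+j)\<close> in the square by exactly \<open>c\<close>. Here \<open>k\<close> counts the
  corrections made.\<close>

lemma truncated_square_root:
  fixes F :: "'a::field_char_0 poly poly"
  assumes "total_degree_le (2 * m) F" "coeff F (2 * m) = 1" "k \<le> m"
  shows "\<exists>G. total_degree_le m G \<and> coeff G m = 1 \<and>
    (\<forall>i\<ge>2 * m - k. coeff (F - G\<^sup>2) i = 0)"
  using assms(3)
proof (induction k)
  case 0
  have "coeff (F - (monom 1 m)\<^sup>2) i = 0" if "i \<ge> 2 * m" for i
  proof (cases "i = 2 * m")
    case True
    thus ?thesis using assms(2) by (simp add: power2_eq_square mult_monom flip: mult_2)
  next
    case False
    with that have "i > 2 * m" by simp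
    hence "coeff F i = 0"
      using assms(1) by (auto simp: total_degree_le_def intro!: poly_eqI)
    thus ?thesis using False by (simp add: power2_eq_square mult_monom flip: mult_2)
  qed
  moreover have "total_degree_le m (monom 1 m :: 'a poly poly)"
    by (auto simp: total_degree_le_def coeff_1)
  ultimately show ?case by (intro exI[of _ "monom 1 m"]) auto
next
  case (Suc k)
  then obtain G where G: "total_degree_le m G" "coeff G m = 1"
    and eq: "\<And>i. i \<ge> 2 * m - k \<Longrightarrow> coeff (F - G\<^sup>2) i = 0" by auto
  define j where "j = m - Suc k"
  have j: "2 * m - Suc k = m + j" "j < m" "m = j + Suc k" using Suc.prems by (auto simp: j_def)
  define c where "c = coeff (F - G\<^sup>2) (m + j)"
  define D where "D = monom (smult (1/2) c) j"
  have Gm: "coeff G i = 0" if "i > m" for i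
    using G(1) that by (auto simp: total_degree_le_def intro!: poly_eqI)
  have sq: "(G + D)\<^sup>2 = G\<^sup>2 + monom c j * G + monom (smult (1/4) (c * c)) (2 * j)"
  proof -
    have "D * D = monom (smult (1/4) (c * c)) (2 * j)"
      by (simp add: D_def mult_monom flip: mult_2)
    moreover have "D + D = monom c j"
      by (simp add: D_def add_monom flip: smult_add_left)
    ultimately show ?thesis
      by (metis (no_types, lifting) add.assoc distrib_left distrib_right mult.commute power2_eq_square)
  qed
  have "coeff (F - (G + D)\<^sup>2) i = 0" if i: "i \<ge> m + j" for i
  proof -
    \<comment> \<open>The square of the correction sits at \<open>T^(2*j)\<close>, below
      \<open>T^(m+j)\<close>, so only the cross term matters in this range.\<close>
    have *: "coeff (F - (G + D)\<^sup>2) i = coeff (F - G\<^sup>2) i - c * coeff G (i - j)"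
      unfolding sq using i j by (simp add: coeff_monom_mult)
    show ?thesis
    proof (cases "i = m + j")
      case True
      thus ?thesis unfolding * using G(2) by (simp add: c_def)
    next
      case False
      hence "i \<ge> 2 * m - k" "i - j > m" using i j by linarith+
      thus ?thesis unfolding * using eq Gm by simp
    qed
  qed
  moreover have "total_degree_le m (G + D)"
  proof -
    \<comment> \<open>Since \<open>F\<close> and the square of \<open>G\<close> have total degree at
      most \<open>2 * m\<close>, the coefficient \<open>c\<close> of \<open>T^(m+j)\<close> has
      degree at most \<open>m - j\<close> in \<open>s\<close>.\<close>
    have "total_degree_le (2 * m) (G\<^sup>2)"
      using total_degree_le_mult[OF G(1) G(1)] by (simp add: power2_eq_square mult_2)
    hence "coeff c l = 0" if "m < j + l" for l
      using assms(1) that unfolding c_def total_degree_le_def by simp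
    thus ?thesis
      using G(1) by (auto simp: total_degree_le_def D_def)
  qed
  moreover have "coeff (G + D) m = 1" using G(2) j by (simp add: D_def)
  ultimately show ?case unfolding j(1) by blast
qed

section \<open>Restriction to lines through the vertex and the algebraic contradiction\<close>

text \<open>Restriction of a plane curve to the vertical line with first coordinate
  \<open>s\<close>, leaving a polynomial in \<open>T\<close>.\<close>

abbreviation specialize :: "'a \<Rightarrow> 'a::comm_semiring_0 poly poly \<Rightarrow> 'a poly" where
  "specialize s \<equiv> map_poly (\<lambda>c. poly c s)"

lemma coeff_specialize [simp]: "coeff (specialize s F) i = poly (coeff F i) s"
  by (simp add: coeff_map_poly)

lemma specialize_mult: "specialize s (F * G) = specialize s F * specialize s G"
  by (rule poly_eqI) (simp add: coeff_mult poly_sum)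

lemma specialize_prod: "specialize s (prod f I) = (\<Prod>i\<in>I. specialize s (f i))"
  by (induction I rule: infinite_finite_induct) (simp_all add: specialize_mult)

lemma poly_specialize: "poly (specialize s F) (poly r s) = poly (poly F r) s"
  by (induction F) (simp_all add: map_poly_pCons)

text \<open>Grouping the factors by the value of \<open>\<rho>\<close>, each root occurs exactly
  twice.\<close>

lemma prod_linear_factors_square:
  fixes \<rho> :: "'i \<Rightarrow> 'a::comm_ring_1"
  assumes "finite I" "\<And>i. i \<in> I \<Longrightarrow> card {j \<in> I. \<rho> j = \<rho> i} = 2"
  shows "(\<Prod>i\<in>I. [:- \<rho> i, 1:]) = (\<Prod>a\<in>\<rho> ` I. [:- a, 1:])\<^sup>2"
proof -
  have "(\<Prod>i\<in>I. [:- \<rho> i, 1:]) = (\<Prod>a\<in>\<rho> ` I. \<Prod>i\<in>{j \<in> I. \<rho> j = a}. [:- \<rho> i, 1:])"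
    by (rule prod.image_gen[OF assms(1)])
  also have "\<dots> = (\<Prod>a\<in>\<rho> ` I. [:- a, 1:]\<^sup>2)"
  proof (rule prod.cong[OF refl])
    fix a assume "a \<in> \<rho> ` I"
    hence "card {j \<in> I. \<rho> j = a} = 2" using assms(2) by auto
    thus "(\<Prod>i\<in>{j \<in> I. \<rho> j = a}. [:- \<rho> i, 1:]) = [:- a, 1:]\<^sup>2"
      using prod_constant[of "[:- a, 1:]" "{j \<in> I. \<rho> j = a}"] by simp
  qed
  finally show ?thesis by (simp add: prod_power_distrib)
qed

lemma monic_prod_linear_factors:
  fixes f :: "'i \<Rightarrow> 'a::idom"
  shows "degree (\<Prod>i\<in>I. [:- f i, 1:]) = card I" "coeff (\<Prod>i\<in>I. [:- f i, 1:]) (card I) = 1"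
proof -
  show "degree (\<Prod>i\<in>I. [:- f i, 1:]) = card I"
    by (subst degree_prod_eq_sum_degree) auto
  thus "coeff (\<Prod>i\<in>I. [:- f i, 1:]) (card I) = 1"
    using lead_coeff_prod[of "\<lambda>i. [:- f i, 1:]" I] by simp
qed

text \<open>The polynomials \<open>r i\<close> stand for the affine lines \<open>T = r i s\<close> in the \<open>(s, T)\<close>-plane, with the
  vertex of the cone at infinity in the \<open>T\<close> direction.\<close>

lemma no_perfect_pairing:
  fixes r :: "'i \<Rightarrow> 'a::field_char_0 poly"
  assumes fin: "finite I" and card_I: "card I = 2 * m" and "0 < m"
    and inj: "inj_on r I" and deg: "\<And>i. i \<in> I \<Longrightarrow> degree (r i) \<le> 1"
    and card_S: "m < card S"
    and pair: "\<And>s i. s \<in> S \<Longrightarrow> i \<in> I \<Longrightarrow> card {j \<in> I. poly (r j) s = poly (r i) s} = 2"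
  shows False
proof -
  define F where "F = (\<Prod>i\<in>I. [:- r i, 1:])"
  have "total_degree_le (2 * m) F"
    unfolding F_def card_I[symmetric]
    by (intro total_degree_le_prod total_degree_le_linear_factor fin deg)
  moreover have "coeff F (2 * m) = 1"
    using monic_prod_linear_factors(2)[of r I] by (simp add: F_def card_I)
  ultimately obtain G where G: "total_degree_le m G" "coeff G m = 1"
    and FG: "\<And>i. i \<ge> m \<Longrightarrow> coeff (F - G\<^sup>2) i = 0"
    using truncated_square_root[of m F m] by auto
  have Gm: "coeff G i = 0" if "i > m" for i
    using G(1) that by (auto simp: total_degree_le_def intro!: poly_eqI)
  have zero: "poly (poly G (r i)) s = 0" if s: "s \<in> S" and i: "i \<in> I" for s i
  proof -
    define V where "V = (\<lambda>i. poly (r i) s) ` I"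
    define H where "H = (\<Prod>a\<in>V. [:- a, 1:])"
    have FH: "specialize s F = H\<^sup>2"
    proof -
      have "specialize s F = (\<Prod>i\<in>I. [:- poly (r i) s, 1:])"
        by (simp add: F_def specialize_prod map_poly_pCons)
      thus ?thesis
        using prod_linear_factors_square[OF fin pair[OF s]] by (simp add: H_def V_def)
    qed
    \<comment> \<open>Comparing degrees shows that the \<open>2 * m\<close> lines meet the vertical
      line in exactly \<open>m\<close> values.\<close>
    have "2 * m = degree (H\<^sup>2)"
      using monic_prod_linear_factors(1)[of "\<lambda>i. poly (r i) s" I]
      unfolding FH[symmetric] by (simp add: F_def specialize_prod map_poly_pCons card_I)
    also have "\<dots> = 2 * card V"
      using monic_prod_linear_factors(1)[of "\<lambda>a. a" V]
      by (simp add: H_def degree_power_eq prod_zero_iff fin V_def)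
    finally have "card V = m" by simp
    hence Hm: "coeff H m = 1"
      using monic_prod_linear_factors(2)[of "\<lambda>a. a" V] by (simp add: H_def)
    define K where "K = specialize s G"
    have "H\<^sup>2 - K\<^sup>2 = specialize s (F - G\<^sup>2)"
    proof -
      have "specialize s (F - G\<^sup>2) = specialize s F - specialize s (G\<^sup>2)"
        by (rule poly_eqI) simp
      thus ?thesis by (simp add: FH K_def power2_eq_square specialize_mult)
    qed
    hence "coeff (H\<^sup>2 - K\<^sup>2) i = 0" if "i \<ge> m" for i
      using FG[OF that] by (simp only: coeff_specialize poly_0)
    \<comment> \<open>If the difference vanishes, its degree is 0 by convention, which is where
      \<open>0 < m\<close> enters.\<close>
    hence small: "degree (H\<^sup>2 - K\<^sup>2) < m"
      using \<open>0 < m\<close> by (metis degree_0 leading_coeff_0_iff not_le)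
    \<comment> \<open>\<open>H + K\<close> has degree \<open>m\<close> while \<open>(H + K) * (H - K)\<close> has smaller degree.\<close>
    have "H = K"
    proof (rule ccontr)
      assume "H \<noteq> K"
      have "coeff (H + K) m \<noteq> 0" using Hm G(2) by (simp add: K_def)
      hence "m \<le> degree (H + K)" "H + K \<noteq> 0"
        by (blast intro: le_degree, metis coeff_0)
      hence "m \<le> degree ((H + K) * (H - K))" using \<open>H \<noteq> K\<close> by (simp add: degree_mult_eq)
      also have "(H + K) * (H - K) = H\<^sup>2 - K\<^sup>2" by (simp add: power2_eq_square algebra_simps)
      finally show False using small by simp
    qed
    moreover have "poly H (poly (r i) s) = 0"
      using i fin by (auto simp: H_def V_def poly_prod prod_zero_iff)
    ultimately show ?thesis by (simp add: K_def poly_specialize)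
  qed
  have "poly G (r i) = 0" if "i \<in> I" for i
  proof (rule ccontr)
    assume nz: "poly G (r i) \<noteq> 0"
    have "S \<subseteq> {s. poly (poly G (r i)) s = 0}" using zero that by blast
    hence "card S \<le> card {s. poly (poly G (r i)) s = 0}"
      by (intro card_mono poly_roots_finite nz)
    also have "\<dots> \<le> degree (poly G (r i))" by (rule card_poly_roots_bound[OF nz])
    also have "\<dots> \<le> m" by (rule degree_poly_le_total_degree[OF G(1) deg[OF that]])
    finally show False using card_S by simp
  qed
  hence sub: "r ` I \<subseteq> {x. poly G x = 0}" by blast
  have "G \<noteq> 0" using G(2) by auto
  \<comment> \<open>The \<open>r i\<close> are \<open>2 * m\<close> distinct roots of
    \<open>G\<close>, read as a polynomial in \<open>T\<close> over the integral domain of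
    polynomials in \<open>s\<close>, but its degree is at most \<open>m\<close>.\<close>
  have "2 * m = card (r ` I)" using card_I card_image[OF inj] by simp
  also have "\<dots> \<le> card {x. poly G x = 0}"
    by (intro card_mono sub poly_roots_finite \<open>G \<noteq> 0\<close>)
  also have "\<dots> \<le> degree G" by (rule card_poly_roots_bound[OF \<open>G \<noteq> 0\<close>])
  also have "\<dots> \<le> m" using Gm by (intro degree_le) auto
  finally show False using \<open>0 < m\<close> by simp
qed

section \<open>Points and lines of the projective plane as subspaces\<close>

lemma subspace_scale_cancel:
  fixes x :: "complex ^ 'n"
  assumes "vec.subspace S" "c *s x \<in> S" "c \<noteq> 0"
  shows "x \<in> S"
  using vec.subspace_scale[OF assms(1,2), of "inverse c"] assms(3) by simp

lemma proj_point_eq_span: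
  assumes "proj_point P" "z \<in> P" "z \<noteq> 0"
  shows "P = vec.span {z}"
proof -
  have "vec.span {z} \<subseteq> P"
    using assms by (intro vec.span_minimal) (auto simp: proj_point_def)
  thus ?thesis
    using assms vec.subspace_dim_equal[of "vec.span {z}" P] by (simp add: proj_point_def)
qed

lemma proj_point_generator:
  assumes "proj_point P"
  obtains z where "z \<noteq> 0" "P = vec.span {z}"
proof -
  have "\<not> P \<subseteq> {0}"
    using assms vec.dim_eq_0[of P] by (auto simp: proj_point_def)
  thus ?thesis using that proj_point_eq_span[OF assms] by blast
qed

lemma proj_point_subset_eq:
  assumes "proj_point P" "proj_point Q" "P \<subseteq> Q"
  shows "P = Q"
  using assms vec.subspace_dim_equal[of P Q] by (simp add: proj_point_def)

lemma proj_line_subset_eq: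
  assumes "proj_line L" "proj_line M" "L \<subseteq> M"
  shows "L = M"
  using assms vec.subspace_dim_equal[of L M] by (simp add: proj_line_def)

text \<open>By the dimension formula in a space of dimension 3, the intersection has dimension at
  least 1; dimension 2 would force the lines to coincide.\<close>

lemma proj_point_Int_lines:
  assumes "proj_line L" "proj_line M" "L \<noteq> M"
  shows "proj_point (L \<inter> M)"
proof -
  have sub: "vec.subspace (L \<inter> M)"
    using assms by (simp add: proj_line_def vec.subspace_inter)
  have "vec.dim {x + y |x y. x \<in> L \<and> y \<in> M} \<le> 3"
    using vec.dim_subset_UNIV[of "{x + y |x y. x \<in> L \<and> y \<in> M}"]
    by (simp add: vec.dimension_def card_cart_basis)
  hence "vec.dim (L \<inter> M) \<ge> 1"
    using vec.dim_sums_Int[of L M] assms by (simp add: proj_line_def)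
  moreover have "\<not> vec.dim (L \<inter> M) \<ge> 2"
  proof
    assume "vec.dim (L \<inter> M) \<ge> 2"
    hence "L \<inter> M = L"
      using assms sub vec.subspace_dim_equal[of "L \<inter> M" L] by (simp add: proj_line_def)
    thus False using proj_line_subset_eq[of L M] assms by blast
  qed
  ultimately show ?thesis using sub by (simp add: proj_point_def)
qed

lemma proj_point_eq_Int_lines:
  assumes "proj_point P" "proj_line L" "proj_line M" "L \<noteq> M" "P \<subseteq> L" "P \<subseteq> M"
  shows "P = L \<inter> M"
  using assms proj_point_subset_eq[OF assms(1) proj_point_Int_lines[OF assms(2-4)]] by blast

lemma subset_join: "P \<subseteq> join P Q" "Q \<subseteq> join P Q"
  using vec.span_superset[of "P \<union> Q"] by (auto simp: join_def)

lemma proj_line_join: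
  assumes "proj_point P" "proj_point Q" "P \<noteq> Q"
  shows "proj_line (join P Q)"
proof -
  obtain a where a: "a \<noteq> 0" "P = vec.span {a}" using proj_point_generator[OF assms(1)] .
  obtain b where b: "b \<noteq> 0" "Q = vec.span {b}" using proj_point_generator[OF assms(2)] .
  have "b \<notin> vec.span {a}"
    using proj_point_eq_span[OF assms(1), of b] a b assms(3) by auto
  hence dim: "vec.dim {b, a} = 2" using a(1) by (simp add: vec.dim_insert)
  have "vec.dim (join P Q) \<le> vec.dim {b, a}"
    unfolding join_def a b vec.dim_span
    by (intro vec.dim_mono Un_least vec.span_mono) auto
  moreover have "{b, a} \<subseteq> join P Q"
    using subset_join(1)[of P Q] subset_join(2)[of Q P]
      vec.span_base[of a "{a}"] vec.span_base[of b "{b}"] unfolding a(2) b(2) by blast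
  hence "vec.dim {b, a} \<le> vec.dim (join P Q)" by (rule vec.dim_subset)
  ultimately show ?thesis using dim by (simp add: proj_line_def join_def)
qed

lemma join_eq_proj_line:
  assumes "proj_point P" "proj_point Q" "P \<noteq> Q" "proj_line X" "P \<subseteq> X" "Q \<subseteq> X"
  shows "join P Q = X"
proof (rule proj_line_subset_eq[OF proj_line_join[OF assms(1-3)] assms(4)])
  show "join P Q \<subseteq> X"
    unfolding join_def using assms by (intro vec.span_minimal) (auto simp: proj_line_def)
qed

text \<open>A plane and a vector outside it span the whole space. This supplies the coefficients of
  lines in affine coordinates.\<close>

lemma proj_line_translate:
  assumes "proj_line L" "w \<notin> L"
  obtains c where "z + c *s w \<in> L"
proof -
  have span: "vec.span L = L" using assms(1) by (simp add: proj_line_def vec.span_eq_iff)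
  have "vec.dim (insert w L) = vec.dimension TYPE(complex) TYPE(3)"
    unfolding vec.dim_insert span
    using assms by (simp add: proj_line_def vec.dimension_def card_cart_basis)
  hence "vec.span (insert w L) = UNIV" using vec.dim_eq_full by blast
  then obtain k where "z - k *s w \<in> L" using vec.span_breakdown_eq[of z w L] span by auto
  hence "z + (- k) *s w \<in> L" by simp
  thus ?thesis by (rule that)
qed

text \<open>With a basis \<open>a\<close>, \<open>b\<close> of \<open>L\<close>, each
  \<open>X\<close> contains at most one vector \<open>a + t *s b\<close>: two of them would put
  \<open>b\<close>, then \<open>a\<close>, then all of \<open>L\<close> into \<open>X\<close>. So
  only finitely many \<open>t\<close> are excluded.\<close>

lemma proj_line_vector_avoiding:
  assumes "proj_line L" "finite R" "\<And>X. X \<in> R \<Longrightarrow> proj_line X \<and> X \<noteq> L"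
  obtains w where "\<And>X. X \<in> R \<Longrightarrow> w \<notin> X"
proof -
  obtain B where B: "B \<subseteq> L" "L \<subseteq> vec.span B" "card B = 2"
    using vec.basis_exists[of L] assms(1) by (metis proj_line_def)
  then obtain a b where ab: "B = {a, b}" by (auto simp: card_2_iff)
  have uniq: "t' = t" if "X \<in> R" and t: "a + t *s b \<in> X" "a + t' *s b \<in> X" for X t t'
  proof (rule ccontr)
    assume "t' \<noteq> t"
    have X: "vec.subspace X" using assms(3)[OF \<open>X \<in> R\<close>] by (simp add: proj_line_def)
    have "(a + t *s b) - (a + t' *s b) \<in> X" using X t by (intro vec.subspace_diff)
    hence "(t - t') *s b \<in> X" by (simp add: vec.scale_left_diff_distrib)
    hence b: "b \<in> X" by (rule subspace_scale_cancel[OF X]) (use \<open>t' \<noteq> t\<close> in simp)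
    hence "(a + t *s b) - t *s b \<in> X" using X t by (intro vec.subspace_diff vec.subspace_scale)
    hence "a \<in> X" by simp
    hence "L \<subseteq> X" using B(2) ab b vec.span_minimal[of B X] X by auto
    thus False using proj_line_subset_eq assms(1) assms(3)[OF \<open>X \<in> R\<close>] by blast
  qed
  have "finite {t. a + t *s b \<in> X}" if "X \<in> R" for X
  proof (cases "\<exists>t. a + t *s b \<in> X")
    case True
    then obtain t where "a + t *s b \<in> X" by blast
    hence "{t. a + t *s b \<in> X} \<subseteq> {t}" using uniq[OF that] by blast
    thus ?thesis by (rule finite_subset) simp
  qed simp
  hence "finite (\<Union>X\<in>R. {t. a + t *s b \<in> X})" using assms(2) by blast
  hence "(\<Union>X\<in>R. {t. a + t *s b \<in> X}) \<noteq> UNIV" using infinite_UNIV_char_0 by metis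
  thus ?thesis using that by blast
qed

lemma finite_intersection_points:
  assumes "line_arrangement A"
  shows "finite (intersection_points A)"
proof (rule finite_subset)
  show "intersection_points A \<subseteq> (\<lambda>(L, M). L \<inter> M) ` (A \<times> A)"
  proof
    fix P assume "P \<in> intersection_points A"
    then obtain L M where "proj_point P" "L \<in> A" "M \<in> A" "L \<noteq> M" "P \<subseteq> L" "P \<subseteq> M"
      by (auto simp: intersection_points_def lies_on_def)
    moreover from this have "P = L \<inter> M"
      using assms by (intro proj_point_eq_Int_lines) (auto simp: line_arrangement_def)
    ultimately show "P \<in> (\<lambda>(L, M). L \<inter> M) ` (A \<times> A)" by auto
  qed
  show "finite ((\<lambda>(L, M). L \<inter> M) ` (A \<times> A))"
    using assms by (simp add: line_arrangement_def)
qed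

text \<open>\<open>R\<close> consists of all lines of the cone through the vertex, including the \<open>e\<close> additional ones.\<close>

locale generic_cone =
  fixes B R :: "(complex ^ 3) set set" and p :: "(complex ^ 3) set"
  assumes generic: "generic_arrangement B"
    and card_B: "3 \<le> card B"
    and vertex: "proj_point p"
    and vertex_off: "\<And>L. L \<in> B \<Longrightarrow> \<not> p \<subseteq> L"
    and finite_R: "finite R"
    and R_line: "\<And>X. X \<in> R \<Longrightarrow> proj_line X"
    and R_vertex: "\<And>X. X \<in> R \<Longrightarrow> p \<subseteq> X"
    and R_join: "\<And>Q. Q \<in> intersection_points B \<Longrightarrow> join p Q \<in> R"
begin

section \<open>Incidences in the cone and the count of double points\<close>

lemma finite_B: "finite B" and B_line: "L \<in> B \<Longrightarrow> proj_line L"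
  using generic by (auto simp: generic_arrangement_def line_arrangement_def)

lemma disjoint: "B \<inter> R = {}"
  using vertex_off R_vertex by blast

lemma arrangement: "line_arrangement (B \<union> R)"
  using finite_B finite_R B_line R_line by (auto simp: line_arrangement_def)

lemma card_lines_through:
  assumes "q \<in> intersection_points B"
  shows "card {L \<in> B. q \<subseteq> L} = 2"
  using assms generic
  by (auto simp: generic_arrangement_def double_points_def point_mult_def lies_on_def)

lemma Int_in_intersection_points:
  assumes "L \<in> B" "M \<in> B" "L \<noteq> M"
  shows "L \<inter> M \<in> intersection_points B"
  using assms proj_point_Int_lines[OF B_line B_line]
  unfolding intersection_points_def lies_on_def by blast

lemma lines_through_unique:
  assumes "L \<in> B" "M \<in> B" "M' \<in> B" "L \<noteq> M" "L \<noteq> M'" "L \<inter> M \<subseteq> M'"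
  shows "M = M'"
proof (rule ccontr)
  assume "M \<noteq> M'"
  have "card {L, M, M'} \<le> card {N \<in> B. L \<inter> M \<subseteq> N}"
    using assms finite_B by (intro card_mono) auto
  thus False
    using card_lines_through[OF Int_in_intersection_points[OF assms(1,2,4)]] assms \<open>M \<noteq> M'\<close> by simp
qed

text \<open>The last claim recovers \<open>X\<close> from its meeting point with \<open>L\<close>;
  the bijection and injectivity arguments below rest on this.\<close>

lemma meet:
  assumes "L \<in> B" "X \<in> R"
  shows "proj_point (L \<inter> X)" "L \<inter> X \<noteq> p" "join p (L \<inter> X) = X"
proof -
  show pt: "proj_point (L \<inter> X)"
    using assms disjoint by (intro proj_point_Int_lines B_line R_line) auto
  show ne: "L \<inter> X \<noteq> p" using vertex_off[OF assms(1)] by blast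
  show "join p (L \<inter> X) = X"
    using assms by (intro join_eq_proj_line vertex pt ne[symmetric] R_line R_vertex) auto
qed

text \<open>The other lines \<open>M\<close> of \<open>B\<close> correspond bijectively to these \<open>X\<close>, since the points \<open>L \<inter> M\<close> are
  distinct by genericity.\<close>

lemma card_nonsimple_meets:
  assumes "L \<in> B"
  shows "card {X \<in> R. L \<inter> X \<in> intersection_points B} = card B - 1"
proof -
  have meetM: "L \<inter> join p (L \<inter> M) = L \<inter> M" "join p (L \<inter> M) \<in> R" if "M \<in> B - {L}" for M
  proof -
    have int: "L \<inter> M \<in> intersection_points B"
      using Int_in_intersection_points assms that by auto
    thus R: "join p (L \<inter> M) \<in> R" by (rule R_join)
    have "proj_point (L \<inter> M)" using int by (simp add: intersection_points_def)
    moreover have "L \<inter> M \<subseteq> L \<inter> join p (L \<inter> M)" using subset_join(2)[of "L \<inter> M" p] by blast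
    ultimately show "L \<inter> join p (L \<inter> M) = L \<inter> M"
      using proj_point_subset_eq meet(1)[OF assms R] by metis
  qed
  have "bij_betw (\<lambda>M. join p (L \<inter> M)) (B - {L}) {X \<in> R. L \<inter> X \<in> intersection_points B}"
  proof (rule bij_betw_imageI)
    show "inj_on (\<lambda>M. join p (L \<inter> M)) (B - {L})"
    proof (rule inj_onI)
      fix M M' assume M: "M \<in> B - {L}" "M' \<in> B - {L}" "join p (L \<inter> M) = join p (L \<inter> M')"
      hence "L \<inter> M = L \<inter> M'" using meetM(1) by metis
      thus "M = M'" using M assms by (intro lines_through_unique[of L M M']) auto
    qed
    show "(\<lambda>M. join p (L \<inter> M)) ` (B - {L}) = {X \<in> R. L \<inter> X \<in> intersection_points B}"
    proof (intro equalityI subsetI)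
      fix X assume "X \<in> (\<lambda>M. join p (L \<inter> M)) ` (B - {L})"
      then obtain M where M: "M \<in> B - {L}" "X = join p (L \<inter> M)" by blast
      hence "L \<inter> M \<in> intersection_points B"
        using assms by (intro Int_in_intersection_points) auto
      thus "X \<in> {X \<in> R. L \<inter> X \<in> intersection_points B}"
        using meetM[OF M(1)] M(2) by simp
    next
      fix X assume "X \<in> {X \<in> R. L \<inter> X \<in> intersection_points B}"
      hence X: "X \<in> R" "L \<inter> X \<in> intersection_points B" by auto
      then obtain M where M: "M \<in> B" "M \<noteq> L" "L \<inter> X \<subseteq> M"
        unfolding intersection_points_def lies_on_def by blast
      have "L \<inter> X = L \<inter> M"
        using M assms by (intro proj_point_eq_Int_lines meet(1) B_line X) auto
      hence "join p (L \<inter> M) = X" using meet(3)[OF assms X(1)] by simp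
      thus "X \<in> (\<lambda>M. join p (L \<inter> M)) ` (B - {L})" using M by blast
    qed
  qed
  thus ?thesis using bij_betw_same_card assms by fastforce
qed

text \<open>No second line of \<open>B\<close> passes through the point, as it would be an
  intersection point of \<open>B\<close>; no second line of \<open>R\<close> does, as the join with
  \<open>p\<close> is unique.\<close>

lemma simple_meet_double_point:
  assumes "L \<in> B" "X \<in> R" "L \<inter> X \<notin> intersection_points B"
  shows "L \<inter> X \<in> double_points (B \<union> R)"
proof -
  note pt = meet[OF assms(1,2)]
  have "L \<noteq> X" using assms disjoint by blast
  have "N = L" if "N \<in> B" "L \<inter> X \<subseteq> N" for N
    using assms that pt(1) unfolding intersection_points_def lies_on_def by blast
  moreover have "N = X" if "N \<in> R" "L \<inter> X \<subseteq> N" for N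
    using join_eq_proj_line[OF vertex pt(1) pt(2)[symmetric] R_line R_vertex] that pt(3) by metis
  ultimately have "{N \<in> B \<union> R. L \<inter> X \<subseteq> N} = {L, X}" using assms by blast
  hence "point_mult (B \<union> R) (L \<inter> X) = 2"
    using \<open>L \<noteq> X\<close> by (simp add: point_mult_def lies_on_def)
  moreover have "L \<inter> X \<in> intersection_points (B \<union> R)"
    using pt(1) \<open>L \<noteq> X\<close> assms unfolding intersection_points_def lies_on_def by blast
  ultimately show ?thesis by (simp add: double_points_def)
qed

lemma card_double_points_ge:
  "card B * (card R - (card B - 1)) \<le> card (double_points (B \<union> R))"
proof -
  define D where "D = (SIGMA L:B. {X \<in> R. L \<inter> X \<notin> intersection_points B})"
  have "card {X \<in> R. L \<inter> X \<notin> intersection_points B} = card R - (card B - 1)" if "L \<in> B" for L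
  proof -
    have "{X \<in> R. L \<inter> X \<notin> intersection_points B} = R - {X \<in> R. L \<inter> X \<in> intersection_points B}"
      by blast
    thus ?thesis using finite_R card_nonsimple_meets[OF that] by (simp add: card_Diff_subset)
  qed
  hence "card D = card B * (card R - (card B - 1))"
    unfolding D_def using finite_B finite_R by (subst card_SigmaI) auto
  \<comment> \<open>Joining the point to \<open>p\<close> recovers \<open>X\<close>; two different
    choices of \<open>L\<close> would make it an intersection point of \<open>B\<close>.\<close>
  moreover have "inj_on (\<lambda>(L, X). L \<inter> X) D"
  proof (rule inj_onI, clarify)
    fix L X M Y assume *: "(L, X) \<in> D" "(M, Y) \<in> D" "L \<inter> X = M \<inter> Y"
    hence "X = Y" using meet(3)[of L X] meet(3)[of M Y] by (auto simp: D_def)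
    moreover have "L = M"
    proof (rule ccontr)
      assume "L \<noteq> M"
      moreover have "L \<in> B" "M \<in> B" "X \<in> R" "L \<inter> X \<subseteq> M" using * by (auto simp: D_def)
      ultimately have "L \<inter> X \<in> intersection_points B"
        using meet(1)[of L X] unfolding intersection_points_def lies_on_def by blast
      thus False using * by (simp add: D_def)
    qed
    ultimately show "L = M \<and> X = Y" by blast
  qed
  moreover have "(\<lambda>(L, X). L \<inter> X) ` D \<subseteq> double_points (B \<union> R)"
    using simple_meet_double_point by (auto simp: D_def)
  moreover have "finite (double_points (B \<union> R))"
    using finite_intersection_points[OF arrangement] by (simp add: double_points_def)
  ultimately show ?thesis using card_inj_on_le by metis
qed

lemma card_R_ge: "card B - 1 \<le> card R"
proof -
  obtain L where "L \<in> B" using card_B by fastforce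
  have "card {X \<in> R. L \<inter> X \<in> intersection_points B} \<le> card R"
    using finite_R by (intro card_mono) auto
  thus ?thesis using card_nonsimple_meets[OF \<open>L \<in> B\<close>] by simp
qed

section \<open>Excluding the minimal number of lines through the vertex\<close>

text \<open>In the equality case every line of \<open>R\<close> meets \<open>B\<close> only in
  intersection points of \<open>B\<close>, each on exactly two lines of \<open>B\<close>. In affine
  coordinates with \<open>p\<close> at infinity this is the pairing refuted by
  \<open>no_perfect_pairing\<close>.\<close>

lemma card_R_neq: "card R \<noteq> card B - 1"
proof
  assume eq: "card R = card B - 1"
  have all: "L \<inter> X \<in> intersection_points B" if "L \<in> B" "X \<in> R" for L X
  proof -
    have "{X \<in> R. L \<inter> X \<in> intersection_points B} = R"
      using card_nonsimple_meets[OF that(1)] eq finite_R by (intro card_subset_eq) auto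
    thus ?thesis using that by blast
  qed
  obtain v where v: "v \<noteq> 0" "p = vec.span {v}" using proj_point_generator[OF vertex] .
  hence v_p: "v \<in> p" by (simp add: vec.span_base)
  have v_B: "v \<notin> L" if "L \<in> B" for L
    using vertex_off[OF that] vec.span_minimal[of "{v}" L] B_line[OF that] v(2)
    by (auto simp: proj_line_def)
  obtain L0 where "L0 \<in> B" using card_B by fastforce
  \<comment> \<open>The span of \<open>v\<close> and \<open>w\<close> will be the line at infinity;
    avoiding \<open>R\<close> keeps every line of \<open>R\<close> in the affine part.\<close>
  have "\<And>X. X \<in> R \<Longrightarrow> proj_line X \<and> X \<noteq> L0" using R_line disjoint \<open>L0 \<in> B\<close> by blast
  then obtain w where w: "\<And>X. X \<in> R \<Longrightarrow> w \<notin> X"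
    using proj_line_vector_avoiding[OF B_line[OF \<open>L0 \<in> B\<close>] finite_R] by metis
  have "R \<noteq> {}" using eq card_B by auto
  hence w_v: "w \<notin> vec.span {v}" using w R_vertex v(2) by blast
  have "vec.dim (vec.span {v, w}) \<noteq> vec.dim (UNIV :: (complex ^ 3) set)"
    using vec.dim_le_card[of "{v, w}" "{v, w}"] card_insert_le_m1[of 2 "{w}" v]
    unfolding vec_dim_card by (simp add: vec.span_superset)
  then obtain u where u: "u \<notin> vec.span {v, w}" by (metis UNIV_eq_I)
  have comb: "x = 0 \<and> y = 0 \<and> z = 0" if "x *s v + y *s u + z *s w = 0" for x y z
  proof -
    have "y = 0"
    proof (rule ccontr)
      assume "y \<noteq> 0"
      have "y *s u = - (x *s v + z *s w)" using that by (simp add: eq_neg_iff_add_eq_0 algebra_simps)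
      moreover have "- (x *s v + z *s w) \<in> vec.span {v, w}"
        by (intro vec.span_neg vec.span_add vec.span_scale vec.span_base) auto
      ultimately show False
        using subspace_scale_cancel[OF vec.subspace_span] u \<open>y \<noteq> 0\<close> by metis
    qed
    moreover have "z = 0"
    proof (rule ccontr)
      assume "z \<noteq> 0"
      have "z *s w = - (x *s v)" using that \<open>y = 0\<close> by (simp add: eq_neg_iff_add_eq_0 algebra_simps)
      moreover have "- (x *s v) \<in> vec.span {v}"
        by (intro vec.span_neg vec.span_scale vec.span_base) auto
      ultimately show False
        using subspace_scale_cancel[OF vec.subspace_span] w_v \<open>z \<noteq> 0\<close> by metis
    qed
    ultimately show ?thesis using that v(1) by simp
  qed
  \<comment> \<open>Affine coordinates \<open>(s, t)\<close> in which all lines of \<open>R\<close> are of the form \<open>s = const\<close>.\<close>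
  define pt where "pt t s = t *s v + u + s *s w" for t s
  have pt_nz: "pt t s \<noteq> 0" for t s using comb[of t 1 s] by (auto simp: pt_def)
  have "\<exists>a b. u + a *s v \<in> L \<and> w + b *s v \<in> L" if "L \<in> B" for L
    using proj_line_translate[OF B_line v_B] that by metis
  then obtain a b where ab: "\<And>L. L \<in> B \<Longrightarrow> u + a L *s v \<in> L" "\<And>L. L \<in> B \<Longrightarrow> w + b L *s v \<in> L"
    by metis
  define r where "r L = [:a L, b L:]" for L
  have pt_L: "pt t s \<in> L \<longleftrightarrow> t = poly (r L) s" if "L \<in> B" for L t s
  proof -
    have L: "vec.subspace L" using B_line[OF that] by (simp add: proj_line_def)
    have "pt (poly (r L) s) s = (u + a L *s v) + s *s (w + b L *s v)"
      by (simp add: pt_def r_def vec.scale_left_distrib vec.scale_right_distrib mult.commute)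
    hence in_L: "pt (poly (r L) s) s \<in> L"
      using ab[OF that] L by (simp only: vec.subspace_add vec.subspace_scale)
    show ?thesis
    proof
      assume "pt t s \<in> L"
      hence "pt t s - pt (poly (r L) s) s \<in> L" using in_L L by (intro vec.subspace_diff)
      hence "(t - poly (r L) s) *s v \<in> L" by (simp add: pt_def vec.scale_left_diff_distrib)
      thus "t = poly (r L) s" using subspace_scale_cancel[OF L] v_B[OF that] by fastforce
    qed (use in_L in simp)
  qed
  have inj_r: "inj_on r B"
  proof (rule inj_onI, rule ccontr)
    fix L M assume LM: "L \<in> B" "M \<in> B" "r L = r M" "L \<noteq> M"
    \<comment> \<open>Equal coefficients would put the independent vectors
      \<open>u + a L *s v\<close> and \<open>w + b L *s v\<close> into the one-dimensional space
      \<open>L \<inter> M\<close>.\<close>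
    have "proj_point (L \<inter> M)" using LM by (intro proj_point_Int_lines B_line)
    moreover have "u + a L *s v \<in> L \<inter> M" "w + b L *s v \<in> L \<inter> M"
      using ab[OF LM(1)] ab[OF LM(2)] LM(3) by (simp_all add: r_def)
    moreover have "u + a L *s v \<noteq> 0" using pt_nz[of "a L" 0] by (simp add: pt_def add.commute)
    ultimately have "w + b L *s v \<in> vec.span {u + a L *s v}" using proj_point_eq_span by blast
    then obtain k where "w + b L *s v = k *s (u + a L *s v)"
      by (auto simp: vec.span_singleton)
    hence "(b L - k * a L) *s v + (- k) *s u + 1 *s w = 0"
      by (simp add: vec.scale_left_diff_distrib vec.scale_right_distrib algebra_simps)
    thus False using comb by fastforce
  qed
  have "\<exists>s. u + s *s w \<in> X" if "X \<in> R" for X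
    using proj_line_translate[OF R_line w] that by metis
  then obtain \<sigma> where \<sigma>: "\<And>X. X \<in> R \<Longrightarrow> u + \<sigma> X *s w \<in> X" by metis
  have pt_X: "pt t (\<sigma> X) \<in> X" if "X \<in> R" for X t
  proof -
    have "t *s v + (u + \<sigma> X *s w) \<in> X"
      using \<sigma>[OF that] R_vertex[OF that] v_p R_line[OF that]
      by (auto simp: proj_line_def intro!: vec.subspace_add vec.subspace_scale)
    thus ?thesis by (simp add: pt_def add.assoc)
  qed
  have "inj_on \<sigma> R"
  proof (rule inj_onI, rule ccontr)
    fix X Y assume XY: "X \<in> R" "Y \<in> R" "\<sigma> X = \<sigma> Y" "X \<noteq> Y"
    \<comment> \<open>A common value of \<open>\<sigma>\<close> would give an affine point lying in
      \<open>p\<close>, although its coordinate along \<open>u\<close> is 1 and \<open>p\<close> is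
      spanned by \<open>v\<close>.\<close>
    have "p = X \<inter> Y" using XY by (intro proj_point_eq_Int_lines vertex R_line R_vertex)
    hence "pt 0 (\<sigma> X) \<in> p" using pt_X[of X 0] pt_X[of Y 0] XY by auto
    then obtain k where "pt 0 (\<sigma> X) = k *s v" unfolding v(2) by (auto simp: vec.span_singleton)
    hence "(- k) *s v + 1 *s u + \<sigma> X *s w = 0" by (simp add: pt_def algebra_simps)
    thus False using comb by fastforce
  qed
  hence card_\<sigma>: "card (\<sigma> ` R) = card B - 1" using eq by (simp add: card_image)
  have pair: "card {M \<in> B. poly (r M) s = poly (r L) s} = 2" if s: "s \<in> \<sigma> ` R" and L: "L \<in> B" for s L
  proof -
    obtain X where X: "X \<in> R" "s = \<sigma> X" using s by blast
    define z where "z = pt (poly (r L) s) s"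
    have "z \<in> L \<inter> X" using pt_L[OF L] pt_X[OF X(1)] X(2) by (simp add: z_def)
    hence span: "L \<inter> X = vec.span {z}"
      using proj_point_eq_span meet(1)[OF L X(1)] pt_nz by (simp add: z_def)
    have "L \<inter> X \<subseteq> M \<longleftrightarrow> poly (r M) s = poly (r L) s" if "M \<in> B" for M
    proof -
      have "L \<inter> X \<subseteq> M \<longleftrightarrow> z \<in> M"
        unfolding span using B_line[OF that] vec.span_minimal[of "{z}" M] vec.span_base[of z "{z}"]
        by (auto simp: proj_line_def)
      thus ?thesis using pt_L[OF that] by (auto simp: z_def)
    qed
    hence "{M \<in> B. poly (r M) s = poly (r L) s} = {M \<in> B. L \<inter> X \<subseteq> M}" by blast
    thus ?thesis using card_lines_through[OF all[OF L X(1)]] by simp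
  qed
  \<comment> \<open>Over a fixed \<open>s\<close> the lines of \<open>B\<close> split into pairs
    with equal values.\<close>
  have "even (card B)"
  proof -
    obtain s where s: "s \<in> \<sigma> ` R" using \<open>R \<noteq> {}\<close> by blast
    have "card B = (\<Sum>t\<in>(\<lambda>L. poly (r L) s) ` B. card {M \<in> B. poly (r M) s = t})"
      using sum.image_gen[OF finite_B, of "\<lambda>_. 1::nat" "\<lambda>L. poly (r L) s"] by simp
    also have "\<dots> = (\<Sum>t\<in>(\<lambda>L. poly (r L) s) ` B. 2)" using pair[OF s] by (intro sum.cong) auto
    finally show ?thesis by simp
  qed
  then obtain m where m: "card B = 2 * m" by (elim evenE)
  show False
  proof (rule no_perfect_pairing[OF finite_B m _ inj_r _ _ pair])
    \<comment> \<open>At least three lines and evenness give \<open>m \<ge> 2\<close>, hence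
      \<open>m < 2 * m - 1\<close>.\<close>
    show "0 < m" "m < card (\<sigma> ` R)" using m card_B card_\<sigma> by linarith+
    show "degree (r L) \<le> 1" for L by (simp add: r_def)
  qed
qed

section \<open>Supersolvability and the final bound\<close>

text \<open>An intersection point on a line of \<open>R\<close> is joined to \<open>p\<close> by
  that line; any other lies on two lines of \<open>B\<close>, so its join is in \<open>R\<close> by
  \<open>R_join\<close>.\<close>

lemma modular_vertex: "modular_point (B \<union> R) p"
proof -
  have "2 \<le> card R" using card_R_ge card_R_neq card_B by linarith
  then obtain T where "T \<subseteq> R" "card T = 2" by (meson obtain_subset_with_card_n)
  then obtain X Y where "X \<in> R" "Y \<in> R" "X \<noteq> Y" by (auto simp: card_2_iff)
  hence "p \<in> intersection_points (B \<union> R)"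
    using vertex R_vertex unfolding intersection_points_def lies_on_def by blast
  moreover have "join p Q \<in> B \<union> R" if Q: "Q \<in> intersection_points (B \<union> R)" "Q \<noteq> p" for Q
  proof (cases "\<exists>X\<in>R. Q \<subseteq> X")
    case True
    then obtain X where "X \<in> R" "Q \<subseteq> X" by blast
    moreover have "proj_point Q" using Q by (simp add: intersection_points_def)
    ultimately have "join p Q = X"
      using Q(2) by (intro join_eq_proj_line vertex R_line R_vertex) auto
    thus ?thesis using \<open>X \<in> R\<close> by blast
  next
    case False
    obtain L M where LM: "proj_point Q" "L \<in> B \<union> R" "M \<in> B \<union> R" "L \<noteq> M" "Q \<subseteq> L" "Q \<subseteq> M"
      using Q(1) by (auto simp: intersection_points_def lies_on_def)
    hence "L \<in> B" "M \<in> B" using False by blast+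
    hence "Q \<in> intersection_points B"
      using LM unfolding intersection_points_def lies_on_def by blast
    thus ?thesis using R_join by blast
  qed
  ultimately show ?thesis by (simp add: modular_point_def)
qed

lemma half_card_le_double_points: "card (B \<union> R) \<le> 2 * card (double_points (B \<union> R))"
proof -
  have "card B \<le> card R" using card_R_ge card_R_neq by linarith
  then obtain k where k: "card R = card B + k" using le_Suc_ex by blast
  hence "card R - (card B - 1) = k + 1" using card_B by linarith
  hence "2 * (card B * (k + 1)) \<le> 2 * card (double_points (B \<union> R))"
    using card_double_points_ge by simp
  moreover have "k \<le> card B * k" using card_B by (cases "card B") auto
  hence "card B + card R \<le> 2 * (card B * (k + 1))" unfolding k by (simp add: algebra_simps)
  moreover have "card (B \<union> R) = card B + card R"
    using finite_B finite_R disjoint by (rule card_Un_disjoint)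
  ultimately show ?thesis by linarith
qed

end

theorem theorem1p8:
  fixes A' A :: "(complex ^ 3) set set" and p :: "(complex ^ 3) set" and e :: nat
  assumes "generic_arrangement A'"
    and "card A' \<ge> 3"
    and "proj_point p"
    and "\<forall>L\<in>A'. \<not> p lies_on L"
    and "is_cone A' p e A"
  shows "supersolvable A \<and> real (card (double_points A)) \<ge> real (card A) / 2"
proof -
  obtain E where E: "finite E" "\<forall>L\<in>E. proj_line L \<and> p lies_on L" "A = cone0 A' p \<union> E"
    using assms(5) unfolding is_cone_def by blast
  define R where "R = join p ` intersection_points A' \<union> E"
  have A: "A = A' \<union> R" using E(3) by (auto simp: R_def cone0_def)
  have join: "proj_line (join p Q)" if "Q \<in> intersection_points A'" for Q
  proof (rule proj_line_join[OF assms(3)])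
    \<comment> \<open>An intersection point lies on a line of \<open>A'\<close>, which the vertex
      avoids.\<close>
    show "proj_point Q" "p \<noteq> Q" using that assms(4) by (auto simp: intersection_points_def)
  qed
  interpret generic_cone A' R p
  proof
    show "finite R"
      using E(1) assms(1) finite_intersection_points by (simp add: R_def generic_arrangement_def)
    show "proj_line X" if "X \<in> R" for X
      using that join E(2) by (auto simp: R_def)
    show "p \<subseteq> X" if "X \<in> R" for X
      using that subset_join(1)[of p] E(2) by (auto simp: R_def lies_on_def)
  qed (use assms in \<open>auto simp: R_def lies_on_def\<close>)
  have "supersolvable A"
    unfolding supersolvable_def A using arrangement modular_vertex by blast
  moreover have "real (card A) \<le> real (2 * card (double_points A))"
    unfolding A of_nat_le_iff by (rule half_card_le_double_points)
  ultimately show ?thesis by simp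
qed

end
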